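(* Let $k,l$ be positive integers and $\mu,\nu$ partitions with $\mu,\nu\subseteq(k^l)$ and $\nu\subseteq\mu^\vee$, where $\mu^\vee=(k-\mu_l,k-\mu_{l-1},\dots,k-\mu_1)$ is the partition whose diagram is $((k^l)/\mu)^\circ$. Let $\mathcal{A}$ be the skew diagram $\mu^\vee/\nu$ (the rectangle $(k^l)$ with $\nu$ removed from the upper left corner and $\mu$ rotated by $180^\circ$ removed from the lower right corner), and let $\beta=\mathcal{B}([\mathcal{A}])$. Then the cover partition of the Schubert product is \[\mathcal{C}([\mu]\star_{(k^l)}[\nu])=\big((k^l)/\beta\big)^\circ=(k-\beta_l,k-\beta_{l-1},\dots,k-\beta_1).\]
   Context: Partitions are identified with Young diagrams (matrix coordinates); $\alpha_i=0$ for $i>l(\alpha)$; $(k^l)$ is the $l\times k$ rectangle; $(\cdot)^\circ$ denotes rotation by $180^\circ$. The Littlewood–Richardson coefficient $c(\lambda;\mu,\nu)$ is the number of semistandard fillings of $\lambda/\mu$ with content $\nu$ whose reverse row word is a lattice word. For a skew diagram $\lambda/\mu$ the skew character is $[\lambda/\mu]=\sum_\alpha c(\lambda;\mu,\alpha)[\alpha]$ (irreducible characters of symmetric groups). The Schubert product is $[\mu]\star_{(k^l)}[\nu]=\sum_{\alpha\subseteq(k^l)}c(\alpha;\mu,\nu)[\alpha]$. For a character $\chi$, $[\alpha]\in\chi$ means $[\alpha]$ has nonzero coefficient in $\chi$; the base partition is $\mathcal{B}(\chi)_i=\min(\alpha_i\mid[\alpha]\in\chi)$ and the cover partition is $\mathcal{C}(\chi)_i=\max(\alpha_i\mid[\alpha]\in\chi)$.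 (For $k\ge\mu_1+\nu_1$, $l\ge l(\mu)+l(\nu)$ the Schubert product is the ordinary product $\sum_\alpha c(\alpha;\mu,\nu)[\alpha]$.) *)

theory Defs
  imports Main "HOL-Library.FuncSet" "HOL-Library.Poly_Mapping"
begin

section \<open>Partitions and diagrams\<close>

text \<open>
  A partition is a weakly decreasing function on the natural numbers with finite support. Rows and
  columns are numbered from \<open>0\<close>, so \<open>\<alpha> i\<close> is the part usually written with index \<open>i + 1\<close>, and
  parts beyond the length are \<open>0\<close>.
\<close>

definition is_partition :: "(nat \<Rightarrow> nat) \<Rightarrow> bool" where
  "is_partition \<alpha> \<longleftrightarrow> antimono \<alpha> \<and> finite {i. \<alpha> i \<noteq> 0}"

definition plength :: "(nat \<Rightarrow> nat) \<Rightarrow> nat" where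
  "plength \<alpha> = card {i. \<alpha> i \<noteq> 0}"

text \<open>Diagrams are in matrix coordinates (row, column).\<close>

definition young :: "(nat \<Rightarrow> nat) \<Rightarrow> (nat \<times> nat) set" where
  "young \<alpha> = {(i, j). j < \<alpha> i}"

definition skew_diagram :: "(nat \<Rightarrow> nat) \<Rightarrow> (nat \<Rightarrow> nat) \<Rightarrow> (nat \<times> nat) set" where
  "skew_diagram \<rho> \<mu> = young \<rho> - young \<mu>"

text \<open>The rectangle \<open>(k\<^sup>l)\<close> has \<open>l\<close> rows of length \<open>k\<close>.\<close>

definition rect :: "nat \<Rightarrow> nat \<Rightarrow> nat \<Rightarrow> nat" where
  "rect k l = (\<lambda>i. if i < l then k else 0)"

text \<open>Rotation by 180 degrees of a set of cells inside the rectangle \<open>(k\<^sup>l)\<close>.\<close>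

definition rotate180 :: "nat \<Rightarrow> nat \<Rightarrow> (nat \<times> nat) set \<Rightarrow> (nat \<times> nat) set" where
  "rotate180 k l D = (\<lambda>(i, j). (l - 1 - i, k - 1 - j)) ` D"

text \<open>
  The partition \<open>(k - \<mu>\<^sub>l, \<dots>, k - \<mu>\<^sub>1)\<close>, for \<open>\<mu>\<close> contained in \<open>(k\<^sup>l)\<close>.
\<close>

definition dual :: "nat \<Rightarrow> nat \<Rightarrow> (nat \<Rightarrow> nat) \<Rightarrow> nat \<Rightarrow> nat" where
  "dual k l \<mu> = (\<lambda>i. if i < l then k - \<mu> (l - 1 - i) else 0)"

lemma young_subset_iff: "young \<alpha> \<subseteq> young \<beta> \<longleftrightarrow> (\<forall>i. \<alpha> i \<le> \<beta> i)"
proof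
  assume sub: "young \<alpha> \<subseteq> young \<beta>"
  show "\<forall>i. \<alpha> i \<le> \<beta> i"
  proof (rule allI, rule ccontr)
    fix i assume "\<not> \<alpha> i \<le> \<beta> i"
    then have "(i, \<beta> i) \<in> young \<alpha>" by (simp add: young_def)
    with sub show False by (auto simp: young_def)
  qed
qed (auto simp: young_def intro: less_le_trans)

lemma young_dual:
  assumes "young \<mu> \<subseteq> young (rect k l)"
  shows "young (dual k l \<mu>) = rotate180 k l (skew_diagram (rect k l) \<mu>)"
proof (intro set_eqI iffI)
  fix c assume "c \<in> young (dual k l \<mu>)"
  then obtain i j where c: "c = (i, j)" "i < l" "j < k - \<mu> (l - 1 - i)"
    by (auto simp: young_def dual_def split: if_splits)
  then have "(l - 1 - i, k - 1 - j) \<in> skew_diagram (rect k l) \<mu>"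
    by (auto simp: skew_diagram_def young_def rect_def)
  moreover have "c = (l - 1 - (l - 1 - i), k - 1 - (k - 1 - j))" using c by auto
  ultimately show "c \<in> rotate180 k l (skew_diagram (rect k l) \<mu>)"
    unfolding rotate180_def by (metis (mono_tags, lifting) case_prod_conv image_eqI)
qed (auto simp: rotate180_def skew_diagram_def young_def rect_def dual_def split: if_splits)

lemma is_partition_dual:
  assumes "is_partition \<mu>" and "young \<mu> \<subseteq> young (rect k l)"
  shows "is_partition (dual k l \<mu>)"
proof -
  have "antimono \<mu>" using assms(1) by (simp add: is_partition_def)
  then have "antimono (dual k l \<mu>)"
    by (auto simp: antimono_def dual_def intro!: diff_le_mono2)
  moreover have "{i. dual k l \<mu> i \<noteq> 0} \<subseteq> {..<l}" by (auto simp: dual_def split: if_splits)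
  ultimately show ?thesis by (auto simp: is_partition_def intro: finite_subset)
qed

lemma finite_young: "is_partition \<alpha> \<Longrightarrow> finite (young \<alpha>)"
proof -
  assume "is_partition \<alpha>"
  then have "finite {i. \<alpha> i \<noteq> 0}" by (simp add: is_partition_def)
  moreover have "young \<alpha> = Sigma {i. \<alpha> i \<noteq> 0} (\<lambda>i. {..<\<alpha> i})" by (auto simp: young_def)
  ultimately show ?thesis by simp
qed

section \<open>Littlewood--Richardson coefficients\<close>

definition semistandard :: "(nat \<times> nat) set \<Rightarrow> (nat \<times> nat \<Rightarrow> nat) \<Rightarrow> bool" where
  "semistandard D T \<longleftrightarrow>
     (\<forall>i j j'. (i, j) \<in> D \<longrightarrow> (i, j') \<in> D \<longrightarrow> j \<le> j' \<longrightarrow> T (i, j) \<le> T (i, j')) \<and>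
     (\<forall>i i' j. (i, j) \<in> D \<longrightarrow> (i', j) \<in> D \<longrightarrow> i < i' \<longrightarrow> T (i, j) < T (i', j))"

text \<open>Entries are \<open>1, 2, \<dots>\<close>; since parts are numbered from \<open>0\<close>, \<open>\<nu> i\<close> counts the entries \<open>i + 1\<close>.\<close>

definition has_content :: "(nat \<times> nat) set \<Rightarrow> (nat \<times> nat \<Rightarrow> nat) \<Rightarrow> (nat \<Rightarrow> nat) \<Rightarrow> bool" where
  "has_content D T \<nu> \<longleftrightarrow> (\<forall>i. card {c \<in> D. T c = Suc i} = \<nu> i)"

text \<open>Rows are read from top to bottom, each from right to left.\<close>

definition reverse_row_word ::
    "(nat \<Rightarrow> nat) \<Rightarrow> (nat \<Rightarrow> nat) \<Rightarrow> (nat \<times> nat \<Rightarrow> nat) \<Rightarrow> nat list" where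
  "reverse_row_word \<rho> \<mu> T =
     concat (map (\<lambda>i. map (\<lambda>j. T (i, j)) (rev [\<mu> i..<\<rho> i])) [0..<plength \<rho>])"

definition lattice_word :: "nat list \<Rightarrow> bool" where
  "lattice_word w \<longleftrightarrow>
     (\<forall>n. \<forall>a\<ge>1. count_list (take n w) (Suc a) \<le> count_list (take n w) a)"

text \<open>
  Fillings are extensional functions, so that distinct functions are distinct fillings and the set
  counted is finite. The coefficient is \<open>0\<close> unless \<open>\<mu>\<close> is contained in \<open>\<rho>\<close>.
\<close>

definition lr_coeff :: "(nat \<Rightarrow> nat) \<Rightarrow> (nat \<Rightarrow> nat) \<Rightarrow> (nat \<Rightarrow> nat) \<Rightarrow> nat" where
  "lr_coeff \<rho> \<mu> \<nu> =
     (if young \<mu> \<subseteq> young \<rho> then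
        card {T. T \<in> skew_diagram \<rho> \<mu> \<rightarrow>\<^sub>E {1..} \<and> semistandard (skew_diagram \<rho> \<mu>) T \<and>
                 has_content (skew_diagram \<rho> \<mu>) T \<nu> \<and>
                 lattice_word (reverse_row_word \<rho> \<mu> T)}
      else 0)"

section \<open>Characters\<close>

text \<open>
  The irreducible characters of the symmetric groups are indexed by partitions and are linearly
  independent. Virtual characters are accordingly taken as elements of the free abelian group on
  the partitions, in which \<^term>\<open>frag_of \<alpha>\<close> stands for \<open>[\<alpha>]\<close>; thus \<open>[\<alpha>] \<in> \<chi>\<close> is
  \<^term>\<open>\<alpha> \<in> Poly_Mapping.keys \<chi>\<close>.
\<close>

type_synonym character = "(nat \<Rightarrow> nat) \<Rightarrow>\<^sub>0 int"

text \<open>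
  In the sum over all partitions only the nonzero terms are kept, so that the index set is
  finite, as shown below.
\<close>

definition skew_character :: "(nat \<Rightarrow> nat) \<Rightarrow> (nat \<Rightarrow> nat) \<Rightarrow> character" where
  "skew_character \<rho> \<mu> =
     (\<Sum>\<alpha> \<in> {\<alpha>. is_partition \<alpha> \<and> lr_coeff \<rho> \<mu> \<alpha> \<noteq> 0}.
        frag_cmul (int (lr_coeff \<rho> \<mu> \<alpha>)) (frag_of \<alpha>))"

definition schubert_product ::
    "nat \<Rightarrow> nat \<Rightarrow> (nat \<Rightarrow> nat) \<Rightarrow> (nat \<Rightarrow> nat) \<Rightarrow> character" where
  "schubert_product k l \<mu> \<nu> =
     (\<Sum>\<alpha> \<in> {\<alpha>. is_partition \<alpha> \<and> young \<alpha> \<subseteq> young (rect k l)}.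
        frag_cmul (int (lr_coeff \<alpha> \<mu> \<nu>)) (frag_of \<alpha>))"

definition base_partition :: "character \<Rightarrow> nat \<Rightarrow> nat" where
  "base_partition \<chi> i = Min {\<alpha> i |\<alpha>. \<alpha> \<in> Poly_Mapping.keys \<chi>}"

definition cover_partition :: "character \<Rightarrow> nat \<Rightarrow> nat" where
  "cover_partition \<chi> i = Max {\<alpha> i |\<alpha>. \<alpha> \<in> Poly_Mapping.keys \<chi>}"

lemma finite_bounded_functions: "finite {\<alpha> :: nat \<Rightarrow> nat. \<forall>i. \<alpha> i \<le> (if i < l then k else 0)}"
proof -
  have "{\<alpha> :: nat \<Rightarrow> nat. \<forall>i. \<alpha> i \<le> (if i < l then k else 0)}
      \<subseteq> {f. \<forall>i. (i \<in> {..<l} \<longrightarrow> f i \<in> {..k}) \<and> (i \<notin> {..<l} \<longrightarrow> f i = 0)}"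
    by (auto split: if_splits)
  then show ?thesis by (rule finite_subset) (rule finite_set_of_finite_funs; simp)
qed

lemma finite_schubert_index: "finite {\<alpha>. is_partition \<alpha> \<and> young \<alpha> \<subseteq> young (rect k l)}"
  by (rule finite_subset[OF _ finite_bounded_functions[of l k]])
     (auto simp: young_subset_iff rect_def)

lemma finite_skew_index:
  assumes "is_partition \<rho>"
  shows "finite {\<alpha>. is_partition \<alpha> \<and> lr_coeff \<rho> \<mu> \<alpha> \<noteq> 0}"
proof -
  define D where "D = skew_diagram \<rho> \<mu>"
  define n where "n = card D"
  have finD: "finite D" using finite_young[OF assms] by (simp add: D_def skew_diagram_def)
  have "\<alpha> i \<le> (if i < n then n else 0)" if part: "is_partition \<alpha>" and nz: "lr_coeff \<rho> \<mu> \<alpha> \<noteq> 0" for \<alpha> i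
  proof -
    obtain T where T: "has_content D T \<alpha>"
    proof -
      have "{T. T \<in> D \<rightarrow>\<^sub>E {1..} \<and> semistandard D T \<and> has_content D T \<alpha> \<and>
               lattice_word (reverse_row_word \<rho> \<mu> T)} \<noteq> {}"
        using nz unfolding lr_coeff_def D_def by (metis (no_types, lifting) card.empty)
      then show ?thesis using that by blast
    qed
    have le: "\<alpha> i \<le> n"
      using T finD by (metis (no_types, lifting) card_mono has_content_def mem_Collect_eq n_def subsetI)
    have "\<alpha> i = 0" if "\<not> i < n"
    proof (rule ccontr)
      assume "\<alpha> i \<noteq> 0"
      have "{..i} \<subseteq> (\<lambda>c. T c - 1) ` D"
      proof
        fix a assume "a \<in> {..i}"
        then have "\<alpha> i \<le> \<alpha> a" using part by (simp add: is_partition_def antimono_def)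
        then have "card {c \<in> D. T c = Suc a} \<noteq> 0" using T \<open>\<alpha> i \<noteq> 0\<close> by (simp add: has_content_def)
        then have "{c \<in> D. T c = Suc a} \<noteq> {}" by (metis card.empty)
        then show "a \<in> (\<lambda>c. T c - 1) ` D" by force
      qed
      then have "card {..i} \<le> n"
        unfolding n_def by (rule surj_card_le[OF finD])
      then show False using that by simp
    qed
    with le show ?thesis by simp
  qed
  then have "{\<alpha>. is_partition \<alpha> \<and> lr_coeff \<rho> \<mu> \<alpha> \<noteq> 0}
      \<subseteq> {\<alpha>. \<forall>i. \<alpha> i \<le> (if i < n then n else 0)}" by blast
  then show ?thesis by (rule finite_subset) (rule finite_bounded_functions)
qed

lemma lookup_skew_character:
  assumes "is_partition \<rho>" and "is_partition \<alpha>"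
  shows "Poly_Mapping.lookup (skew_character \<rho> \<mu>) \<alpha> = int (lr_coeff \<rho> \<mu> \<alpha>)"
  using finite_skew_index[OF assms(1), of \<mu>] assms(2)
  by (simp add: skew_character_def lookup_sum if_distrib sum.delta cong: if_cong)

lemma lookup_schubert_product:
  assumes "is_partition \<alpha>" and "young \<alpha> \<subseteq> young (rect k l)"
  shows "Poly_Mapping.lookup (schubert_product k l \<mu> \<nu>) \<alpha> = int (lr_coeff \<alpha> \<mu> \<nu>)"
  using finite_schubert_index[of k l] assms
  by (simp add: schubert_product_def lookup_sum if_distrib sum.delta cong: if_cong)

end

theory Submission
  imports Defs
begin

text \<open>
  A Littlewood--Richardson filling of \<open>\<rho>/\<mu>\<close> with content \<open>\<nu>\<close> is the same thing as an integral hive, a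
  triangular array whose three sides have the differences \<open>\<mu>\<close>, \<open>\<nu>\<close> and \<open>\<rho>\<close>, and the three families of
  rhombus inequalities are permuted when the triangle is turned by 120 degrees. After adding a linear
  term, the turned hive has the sides \<open>\<nu>\<close>, \<open>\<rho>\<^sup>\<or>\<close> and \<open>\<mu>\<^sup>\<or>\<close>. Hence
  \<open>c(\<alpha>;\<mu>,\<nu>) \<noteq> 0\<close> if and only if \<open>c(\<mu>\<^sup>\<or>;\<nu>,\<alpha>\<^sup>\<or>) \<noteq> 0\<close>, so \<open>\<alpha> \<mapsto> \<alpha>\<^sup>\<or>\<close> carries the constituents of the
  Schubert product to those of the skew character and exchanges maxima of parts with minima.
\<close>

section \<open>Reading words\<close>

lemma lattice_word_append:
  "lattice_word (xs @ ys) \<longleftrightarrow> lattice_word xs \<and>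
     (\<forall>n. \<forall>a\<ge>1. count_list (xs @ take n ys) (Suc a) \<le> count_list (xs @ take n ys) a)"
  (is "?L \<longleftrightarrow> ?X \<and> ?Y")
proof
  define ok where "ok w \<longleftrightarrow> (\<forall>a\<ge>1. count_list w (Suc a) \<le> count_list w a)" for w :: "nat list"
  have ok: "lattice_word w \<longleftrightarrow> (\<forall>n. ok (take n w))" for w
    by (simp only: lattice_word_def ok_def)
  have Y: "?Y \<longleftrightarrow> (\<forall>n. ok (xs @ take n ys))" by (simp only: ok_def)
  {
    assume "?L"
    then have all: "ok (take n (xs @ ys))" for n by (simp only: ok)
    have "ok (take n xs)" for n using all[of "min n (length xs)"] by (simp add: min_def split: if_splits)
    moreover have "ok (xs @ take n ys)" for n using all[of "length xs + n"] by simp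
    ultimately show "?X \<and> ?Y" unfolding ok Y by blast
  next
    assume "?X \<and> ?Y"
    then have X: "ok (take n xs)" and Y: "ok (xs @ take n ys)" for n by (simp_all only: ok Y)
    have "ok (take n (xs @ ys))" for n
      using X[of n] Y[of "n - length xs"] by (cases "n \<le> length xs") auto
    then show ?L unfolding ok by blast
  }
qed

text \<open>A prefix of a concatenation consists of complete blocks followed by an initial piece of
  the next block; the blocks will be the rows of a filling.\<close>

lemma lattice_word_concat:
  "lattice_word (concat (map f [0..<m])) \<longleftrightarrow>
     (\<forall>i<m. \<forall>n. \<forall>a\<ge>1. count_list (concat (map f [0..<i]) @ take n (f i)) (Suc a)
                       \<le> count_list (concat (map f [0..<i]) @ take n (f i)) a)"
proof (induction m)
  case 0
  show ?case by (simp add: lattice_word_def)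
next
  case (Suc m)
  have eq: "concat (map f [0..<Suc m]) = concat (map f [0..<m]) @ f m" by simp
  show ?case unfolding eq lattice_word_append Suc.IH less_Suc_eq by blast
qed

lemma count_list_map_upt:
  "count_list (map g (rev [a..<b])) v = card {c \<in> {a..<b}. g c = v}"
proof (induction b)
  case (Suc b)
  show ?case
  proof (cases "a \<le> b")
    case True
    then have "{c \<in> {a..<Suc b}. g c = v} =
        (if g b = v then insert b {c \<in> {a..<b}. g c = v} else {c \<in> {a..<b}. g c = v})"
      by (auto simp: less_Suc_eq)
    with Suc True show ?thesis by auto
  qed (use Suc in auto)
qed simp

lemma count_list_concat_upt:
  "count_list (concat (map f [0..<i])) v = (\<Sum>r<i. count_list (f r) v)"
  by (induction i) auto

section \<open>The lattice condition row by row\<close>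

definition row_count :: "(nat \<Rightarrow> nat) \<Rightarrow> (nat \<Rightarrow> nat) \<Rightarrow> (nat \<times> nat \<Rightarrow> nat) \<Rightarrow> nat \<Rightarrow> nat \<Rightarrow> nat" where
  "row_count \<rho> \<mu> T r v = card {c \<in> {\<mu> r..<\<rho> r}. T (r, c) = v}"

lemma support_eq_lessThan_plength:
  assumes "is_partition \<rho>"
  shows "{i. \<rho> i \<noteq> 0} = {..<plength \<rho>}"
proof -
  have fin: "finite {i. \<rho> i \<noteq> 0}" and anti: "antimono \<rho>" using assms by (auto simp: is_partition_def)
  have ex: "\<exists>n. \<rho> n = 0"
  proof (rule ccontr)
    assume "\<nexists>n. \<rho> n = 0"
    then have "{i. \<rho> i \<noteq> 0} = UNIV" by simp
    then show False using fin infinite_UNIV_nat by simp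
  qed
  define n where "n = (LEAST n. \<rho> n = 0)"
  have "\<rho> n = 0" unfolding n_def using ex by (rule LeastI_ex)
  then have "\<rho> i = 0" if "i \<ge> n" for i using anti that by (metis antimonoD le_zero_eq)
  moreover have "\<rho> i \<noteq> 0" if "i < n" for i using that not_less_Least unfolding n_def by blast
  ultimately have "\<rho> i \<noteq> 0 \<longleftrightarrow> i < n" for i by (cases "i < n") auto
  then have "{i. \<rho> i \<noteq> 0} = {..<n}" by auto
  then show ?thesis by (simp add: plength_def)
qed

text \<open>Rows from \<open>plength \<rho>\<close> on are empty and contribute no letters. This
  allows a common number \<open>l\<close> of rows, the height of the rectangle, for all shapes to be
  compared.\<close>

lemma reverse_row_word_upto:
  assumes "is_partition \<rho>" and "\<forall>i\<ge>l. \<rho> i = 0"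
  shows "reverse_row_word \<rho> \<mu> T =
    concat (map (\<lambda>i. map (\<lambda>j. T (i, j)) (rev [\<mu> i..<\<rho> i])) [0..<l])"
proof -
  let ?p = "plength \<rho>"
  have S: "\<rho> i = 0 \<longleftrightarrow> i \<ge> ?p" for i
    using support_eq_lessThan_plength[OF assms(1)] by (metis (mono_tags, lifting) lessThan_iff mem_Collect_eq not_le)
  have "?p \<le> l" using S assms(2) by blast
  then have "[0..<l] = [0..<?p] @ [?p..<l]" by (metis le0 upt_add_eq_append le_add_diff_inverse)
  then show ?thesis using S by (auto simp: reverse_row_word_def)
qed

text \<open>Rows are read from right to left, so a prefix is made up of all rows above some row
  \<open>i\<close> and the cells of row \<open>i\<close> from a column \<open>b\<close> on; for
  \<open>b = \<rho> i\<close> nothing of row \<open>i\<close> has been read.\<close>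

lemma lattice_word_iff_row_counts:
  assumes "is_partition \<rho>" and "\<forall>i\<ge>l. \<rho> i = 0" and "\<And>i. \<mu> i \<le> \<rho> i"
  shows "lattice_word (reverse_row_word \<rho> \<mu> T) \<longleftrightarrow>
    (\<forall>i<l. \<forall>b\<in>{\<mu> i..\<rho> i}. \<forall>a\<ge>1.
       (\<Sum>r<i. row_count \<rho> \<mu> T r (Suc a)) + card {c \<in> {b..<\<rho> i}. T (i, c) = Suc a}
       \<le> (\<Sum>r<i. row_count \<rho> \<mu> T r a) + card {c \<in> {b..<\<rho> i}. T (i, c) = a})"
proof -
  let ?f = "\<lambda>i. map (\<lambda>j. T (i, j)) (rev [\<mu> i..<\<rho> i])"
  let ?Q = "\<lambda>i b a. (\<Sum>r<i. row_count \<rho> \<mu> T r (Suc a)) + card {c \<in> {b..<\<rho> i}. T (i, c) = Suc a}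
       \<le> (\<Sum>r<i. row_count \<rho> \<mu> T r a) + card {c \<in> {b..<\<rho> i}. T (i, c) = a}"
  \<comment> \<open>The truncated subtraction keeps the start at \<open>\<mu> i\<close> when
    \<open>n\<close> exceeds the length of the row.\<close>
  have t: "take n (?f i) = map (\<lambda>j. T (i, j)) (rev [\<mu> i + (\<rho> i - \<mu> i - n)..<\<rho> i])" for n i
    by (simp add: take_map take_rev drop_upt)
  have cnt: "count_list (concat (map ?f [0..<i]) @ take n (?f i)) v =
      (\<Sum>r<i. row_count \<rho> \<mu> T r v) + card {c \<in> {\<mu> i + (\<rho> i - \<mu> i - n)..<\<rho> i}. T (i, c) = v}" for i n v
    unfolding count_list_append t count_list_map_upt count_list_concat_upt row_count_def ..
  have "lattice_word (reverse_row_word \<rho> \<mu> T) \<longleftrightarrow>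
      (\<forall>i<l. \<forall>n. \<forall>a\<ge>1. ?Q i (\<mu> i + (\<rho> i - \<mu> i - n)) a)"
    unfolding reverse_row_word_upto[OF assms(1,2)] lattice_word_concat cnt ..
  also have "\<dots> \<longleftrightarrow> (\<forall>i<l. \<forall>b\<in>{\<mu> i..\<rho> i}. \<forall>a\<ge>1. ?Q i b a)" (is "?L = ?R")
  proof
    assume L: ?L
    show ?R
    proof (intro allI ballI impI)
      fix i b a :: nat
      assume "i < l" and b: "b \<in> {\<mu> i..\<rho> i}" and a: "1 \<le> a"
      have eq: "\<mu> i + (\<rho> i - \<mu> i - (\<rho> i - b)) = b" using b by auto
      have "?Q i (\<mu> i + (\<rho> i - \<mu> i - (\<rho> i - b))) a" using L \<open>i < l\<close> a by blast
      then show "?Q i b a" unfolding eq .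
    qed
  next
    assume R: ?R
    have "\<mu> i + (\<rho> i - \<mu> i - n) \<in> {\<mu> i..\<rho> i}" for i n using assms(3)[of i] by auto
    with R show ?L by blast
  qed
  finally show ?thesis .
qed

section \<open>Hives\<close>

definition lr_filling :: "(nat \<Rightarrow> nat) \<Rightarrow> (nat \<Rightarrow> nat) \<Rightarrow> (nat \<Rightarrow> nat) \<Rightarrow> (nat \<times> nat \<Rightarrow> nat) \<Rightarrow> bool" where
  "lr_filling \<rho> \<mu> \<nu> T \<longleftrightarrow>
     T \<in> skew_diagram \<rho> \<mu> \<rightarrow>\<^sub>E {1..} \<and> semistandard (skew_diagram \<rho> \<mu>) T \<and>
     has_content (skew_diagram \<rho> \<mu>) T \<nu> \<and> lattice_word (reverse_row_word \<rho> \<mu> T)"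

text \<open>
  A filling corresponds to \<open>h i j = (\<Sum>r<i. \<mu> r + number of entries \<le> j in row r)\<close>. The hive proper is the
  part \<open>j \<le> i \<le> l\<close>; since row \<open>r\<close> has entries at most \<open>r + 1\<close>, \<open>h i\<close> is constant from \<open>j = i\<close> on. The
  last three clauses say that entry counts are nonnegative, that columns increase strictly, and that
  the reading word is a lattice word.
\<close>

definition lr_hive :: "nat \<Rightarrow> (nat \<Rightarrow> nat) \<Rightarrow> (nat \<Rightarrow> nat) \<Rightarrow> (nat \<Rightarrow> nat) \<Rightarrow> (nat \<Rightarrow> nat \<Rightarrow> int) \<Rightarrow> bool" where
  "lr_hive l \<rho> \<mu> \<nu> h \<longleftrightarrow>
     (\<forall>i\<le>l. h i 0 = (\<Sum>r<i. int (\<mu> r))) \<and>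
     (\<forall>i\<le>l. \<forall>j\<ge>i. h i j = (\<Sum>r<i. int (\<rho> r))) \<and>
     (\<forall>j. h l (Suc j) = h l j + int (\<nu> j)) \<and>
     (\<forall>i<l. \<forall>j. h i (Suc j) + h (Suc i) j \<le> h (Suc i) (Suc j) + h i j) \<and>
     (\<forall>i j. Suc i < l \<longrightarrow> h (Suc (Suc i)) (Suc j) + h i j \<le> h (Suc i) (Suc j) + h (Suc i) j) \<and>
     (\<forall>i<l. \<forall>j. h (Suc i) (Suc (Suc j)) + h i j \<le> h (Suc i) (Suc j) + h i (Suc j))"

lemma mem_skew_diagram: "(i, c) \<in> skew_diagram \<rho> \<mu> \<longleftrightarrow> \<mu> i \<le> c \<and> c < \<rho> i"
  by (auto simp: skew_diagram_def young_def)

section \<open>From fillings to hives\<close>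

lemma mem_initial_segment_iff:
  fixes S :: "nat set"
  assumes "S \<subseteq> {a..}" and "finite S"
    and "\<And>c d. d \<in> S \<Longrightarrow> a \<le> c \<Longrightarrow> c \<le> d \<Longrightarrow> c \<in> S" and "a \<le> c"
  shows "c \<in> S \<longleftrightarrow> c < a + card S"
proof
  assume "c \<in> S"
  then have "{a..c} \<subseteq> S" using assms by auto
  then have "card {a..c} \<le> card S" using assms(2) by (rule card_mono[rotated])
  then show "c < a + card S" using assms(4) by simp
next
  assume lt: "c < a + card S"
  show "c \<in> S"
  proof (rule ccontr)
    assume "c \<notin> S"
    then have "S \<subseteq> {a..<c}" using assms by (metis atLeastLessThan_iff atLeast_iff not_le subset_iff)
    then have "card S \<le> card {a..<c}" by (intro card_mono) auto
    then show False using lt assms(4) by simp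
  qed
qed

lemma card_skew_entries:
  assumes "\<forall>i\<ge>l. \<rho> i = 0"
  shows "card {c \<in> skew_diagram \<rho> \<mu>. T c = v} = (\<Sum>r<l. row_count \<rho> \<mu> T r v)"
proof -
  have "i < l" if "c < \<rho> i" for i c using assms that by (metis leI not_less0)
  then have "{c \<in> skew_diagram \<rho> \<mu>. T c = v} = (SIGMA r:{..<l}. {c \<in> {\<mu> r..<\<rho> r}. T (r, c) = v})"
    by (auto simp: mem_skew_diagram)
  then show ?thesis by (simp add: row_count_def)
qed

text \<open>Besides the hive, a bound on the entries is extracted, for the finiteness of the set of
  fillings.\<close>

lemma lr_filling_imp_hive:
  assumes \<rho>: "is_partition \<rho>" and \<mu>: "is_partition \<mu>" and l: "\<forall>i\<ge>l. \<rho> i = 0"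
    and sub: "\<And>i. \<mu> i \<le> \<rho> i" and T: "lr_filling \<rho> \<mu> \<nu> T"
  shows "(\<exists>h. lr_hive l \<rho> \<mu> \<nu> h) \<and> (\<forall>c \<in> skew_diagram \<rho> \<mu>. T c \<le> l)"
proof -
  let ?D = "skew_diagram \<rho> \<mu>" and ?N = "row_count \<rho> \<mu> T"
  define E where "E r j = card {c \<in> {\<mu> r..<\<rho> r}. T (r, c) \<le> j}" for r j
  define h where "h i j = (\<Sum>r<i. int (\<mu> r + E r j))" for i j
  have anti\<rho>: "antimono \<rho>" and anti\<mu>: "antimono \<mu>" using \<rho> \<mu> by (auto simp: is_partition_def)
  have pos: "1 \<le> T c" if "c \<in> ?D" for c using T that unfolding lr_filling_def by (auto dest: PiE_mem)
  have row: "T (r, c) \<le> T (r, d)" if "\<mu> r \<le> c" "c \<le> d" "d < \<rho> r" for r c d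
    using T that unfolding lr_filling_def semistandard_def by (auto simp: mem_skew_diagram)
  have col: "T (r, c) < T (Suc r, c)" if "\<mu> r \<le> c" "c < \<rho> (Suc r)" for r c
  proof -
    have "\<mu> (Suc r) \<le> \<mu> r" "\<rho> (Suc r) \<le> \<rho> r" using anti\<mu> anti\<rho> by (auto simp: antimono_def)
    then show ?thesis
      using T that unfolding lr_filling_def semistandard_def by (auto simp: mem_skew_diagram)
  qed
  \<comment> \<open>Rows increase weakly, so the entries at most \<open>j\<close> fill a left
    segment of row \<open>r\<close>, and \<open>\<mu> r + E r j\<close> is the column at which it
    ends.\<close>
  have le_iff: "T (r, c) \<le> j \<longleftrightarrow> c < \<mu> r + E r j" if "\<mu> r \<le> c" "c < \<rho> r" for r c j
  proof -
    have "c \<in> {c \<in> {\<mu> r..<\<rho> r}. T (r, c) \<le> j} \<longleftrightarrow> c < \<mu> r + E r j"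
      unfolding E_def by (rule mem_initial_segment_iff) (use that in \<open>auto intro: row order_trans\<close>)
    then show ?thesis using that by simp
  qed
  have E_le: "\<mu> r + E r j \<le> \<rho> r" for r j
  proof -
    have "E r j \<le> card {\<mu> r..<\<rho> r}" unfolding E_def by (rule card_mono) auto
    then show ?thesis using sub[of r] by simp
  qed
  have E0: "E r 0 = 0" for r
  proof -
    have "{c \<in> {\<mu> r..<\<rho> r}. T (r, c) \<le> 0} = {}" using pos by (force simp: mem_skew_diagram)
    then show ?thesis unfolding E_def by (metis card.empty)
  qed
  have E_Suc: "E r (Suc j) = E r j + ?N r (Suc j)" for r j
  proof -
    have "{c \<in> {\<mu> r..<\<rho> r}. T (r, c) \<le> Suc j} =
        {c \<in> {\<mu> r..<\<rho> r}. T (r, c) \<le> j} \<union> {c \<in> {\<mu> r..<\<rho> r}. T (r, c) = Suc j}" by auto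
    then show ?thesis unfolding E_def row_count_def by (simp add: card_Un_disjoint disjoint_iff)
  qed
  have lat: "(\<Sum>r<Suc i. ?N r (Suc (Suc j))) \<le> (\<Sum>r<i. ?N r (Suc j))" if "i < l" for i j
  proof -
    \<comment> \<open>The prefix stopping at \<open>?b\<close> gives the sharpest inequality: in row
      \<open>i\<close> exactly the entries above \<open>j + 1\<close> have been read, so all its
      entries \<open>j + 2\<close> are counted and none of its entries \<open>j + 1\<close>.\<close>
    let ?b = "\<mu> i + E i (Suc j)"
    have "?b \<in> {\<mu> i..\<rho> i}" using E_le by simp
    moreover have "lattice_word (reverse_row_word \<rho> \<mu> T)" using T by (simp add: lr_filling_def)
    moreover note lattice_word_iff_row_counts[OF \<rho> l sub, THEN iffD1, rule_format, of T i ?b "Suc j"]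
    ultimately have ineq: "(\<Sum>r<i. ?N r (Suc (Suc j))) + card {c \<in> {?b..<\<rho> i}. T (i, c) = Suc (Suc j)}
       \<le> (\<Sum>r<i. ?N r (Suc j)) + card {c \<in> {?b..<\<rho> i}. T (i, c) = Suc j}"
      using that by simp
    have big: "?b \<le> c \<longleftrightarrow> Suc j < T (i, c)" if "\<mu> i \<le> c" "c < \<rho> i" for c
      using le_iff[OF that, of "Suc j"] by linarith
    have "T (i, c) \<noteq> Suc j" if "?b \<le> c" "c < \<rho> i" for c
      using big[of c] that by simp
    then have e1: "{c \<in> {?b..<\<rho> i}. T (i, c) = Suc j} = {}" by auto
    have "?b \<le> c" if "\<mu> i \<le> c" "c < \<rho> i" "T (i, c) = Suc (Suc j)" for c
      using big[of c] that by simp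
    then have e2: "{c \<in> {?b..<\<rho> i}. T (i, c) = Suc (Suc j)} =
        {c \<in> {\<mu> i..<\<rho> i}. T (i, c) = Suc (Suc j)}" by auto
    show ?thesis using ineq unfolding e1 e2 row_count_def by simp
  qed
  \<comment> \<open>A letter \<open>j + 2\<close> in row \<open>i\<close> requires a letter
    \<open>j + 1\<close> in an earlier row. By induction row \<open>i\<close> has no entries above
    \<open>i + 1\<close>.\<close>
  have N_zero: "?N i (Suc (Suc j)) = 0" if "i < l" "i \<le> j" for i j
    using that
  proof (induction i arbitrary: j rule: less_induct)
    case (less i)
    have "?N r (Suc j) = 0" if "r < i" for r
      using less.IH[OF that, of "j - 1"] less.prems that by (cases j) auto
    then have "(\<Sum>r<i. ?N r (Suc j)) = 0" by simp
    then have "(\<Sum>r<Suc i. ?N r (Suc (Suc j))) = 0" using lat[OF less.prems(1), of j] by simp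
    then show ?case by simp
  qed
  have bound: "T (i, c) \<le> Suc i" if "\<mu> i \<le> c" "c < \<rho> i" for i c
  proof (rule ccontr)
    assume "\<not> T (i, c) \<le> Suc i"
    then have "\<exists>j\<ge>i. T (i, c) = Suc (Suc j)" by (metis Suc_leD Suc_le_D not_less_eq_eq Suc_le_mono)
    then obtain j where j: "i \<le> j" "T (i, c) = Suc (Suc j)" by blast
    have "i < l" using l that by (metis not_le not_less0)
    then have "{c \<in> {\<mu> i..<\<rho> i}. T (i, c) = Suc (Suc j)} = {}"
      using N_zero[of i j] j by (simp add: row_count_def)
    then show False using that j by auto
  qed
  have E_full: "\<mu> r + E r j = \<rho> r" if "r < j" for r j
  proof -
    have "{c \<in> {\<mu> r..<\<rho> r}. T (r, c) \<le> j} = {\<mu> r..<\<rho> r}" using bound that by fastforce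
    then show ?thesis using sub[of r] by (simp add: E_def)
  qed
  \<comment> \<open>Otherwise the first cell of row \<open>r\<close> past the entries at most
    \<open>j\<close> holds more than \<open>j\<close>, while the cell below it holds at most
    \<open>j + 1\<close>, against strictness of columns.\<close>
  have step: "\<mu> (Suc r) + E (Suc r) (Suc j) \<le> \<mu> r + E r j" for r j
  proof (rule ccontr)
    let ?c = "\<mu> r + E r j"
    assume "\<not> ?thesis"
    then have c: "?c < \<mu> (Suc r) + E (Suc r) (Suc j)" by simp
    then have "?c < \<rho> (Suc r)" using E_le less_le_trans by blast
    moreover have "\<mu> (Suc r) \<le> \<mu> r" "\<rho> (Suc r) \<le> \<rho> r" using anti\<mu> anti\<rho> by (auto simp: antimono_def)
    ultimately have "T (Suc r, ?c) \<le> Suc j" "\<not> T (r, ?c) \<le> j" "T (r, ?c) < T (Suc r, ?c)"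
      using c le_iff[of "Suc r" ?c "Suc j"] le_iff[of r ?c j] col[of r ?c] by auto
    then show False by simp
  qed
  have h_Suc: "h (Suc i) j = h i j + int (\<mu> i + E i j)" for i j by (simp add: h_def)
  have h_step: "h i (Suc j) = h i j + (\<Sum>r<i. int (?N r (Suc j)))" for i j
    by (simp add: h_def E_Suc sum.distrib)
  have "lr_hive l \<rho> \<mu> \<nu> h" unfolding lr_hive_def
  proof (intro conjI allI impI)
    fix j
    have "card {c \<in> ?D. T c = Suc j} = \<nu> j" using T by (simp add: lr_filling_def has_content_def)
    then show "h l (Suc j) = h l j + int (\<nu> j)"
      unfolding h_step card_skew_entries[OF l] by (metis of_nat_sum)
  next
    fix i j :: nat assume "i < l"
    show "h i (Suc j) + h (Suc i) j \<le> h (Suc i) (Suc j) + h i j"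
      unfolding h_Suc E_Suc by simp
    have "int (\<Sum>r<Suc i. ?N r (Suc (Suc j))) \<le> int (\<Sum>r<i. ?N r (Suc j))"
      using lat[OF \<open>i < l\<close>] by (rule of_nat_mono)
    then show "h (Suc i) (Suc (Suc j)) + h i j \<le> h (Suc i) (Suc j) + h i (Suc j)"
      unfolding h_step[of _ "Suc j"] h_step[of i j] by simp
  next
    fix i j :: nat
    show "h (Suc (Suc i)) (Suc j) + h i j \<le> h (Suc i) (Suc j) + h (Suc i) j"
      unfolding h_Suc using step[of i j] by (simp flip: of_nat_add)
  next
    fix i :: nat show "h i 0 = (\<Sum>r<i. int (\<mu> r))" by (simp add: h_def E0)
  next
    fix i j :: nat assume "i \<le> j"
    then show "h i j = (\<Sum>r<i. int (\<rho> r))" unfolding h_def using E_full by (intro sum.cong) auto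
  qed
  moreover have "T (i, c) \<le> l" if "(i, c) \<in> ?D" for i c
  proof -
    have "i < l" using that l by (metis mem_skew_diagram leI not_less0)
    then show ?thesis using bound[of i c] that by (simp add: mem_skew_diagram)
  qed
  ultimately show ?thesis by auto
qed

section \<open>From hives to fillings\<close>

lemma hive_imp_lr_filling:
  assumes \<rho>: "is_partition \<rho>" and \<mu>: "is_partition \<mu>" and l: "\<forall>i\<ge>l. \<rho> i = 0"
    and sub: "\<And>i. \<mu> i \<le> \<rho> i" and h: "lr_hive l \<rho> \<mu> \<nu> h"
  shows "\<exists>T. lr_filling \<rho> \<mu> \<nu> T"
proof -
  let ?D = "skew_diagram \<rho> \<mu>" and ?N = "row_count \<rho> \<mu>"
  \<comment> \<open>\<open>P i j\<close> is meant as the column where the entries at most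
    \<open>j\<close> end in row \<open>i\<close>. Two rhombus families say that it increases with
    \<open>j\<close> and that \<open>P (Suc i) (Suc j) \<le> P i j\<close>; the third is the lattice
    condition.\<close>
  define P where "P i j = h (Suc i) j - h i j" for i j
  have anti\<rho>: "antimono \<rho>" and anti\<mu>: "antimono \<mu>" using \<rho> \<mu> by (auto simp: is_partition_def)
  have P0: "P i 0 = int (\<mu> i)" if "i < l" for i
    using h that by (simp add: lr_hive_def P_def)
  have Pfull: "P i j = int (\<rho> i)" if "i < l" "i < j" for i j
    using h that by (simp add: lr_hive_def P_def)
  have Pmono1: "P i j \<le> P i (Suc j)" if "i < l" for i j
    using h that by (simp add: lr_hive_def P_def algebra_simps)
  have Pmono: "P i j \<le> P i j'" if "i < l" "j \<le> j'" for i j j'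
    by (rule lift_Suc_mono_le[of "P i", OF _ that(2)]) (rule Pmono1[OF that(1)])
  have Pstep: "P (Suc i) (Suc j) \<le> P i j" if "Suc i < l" for i j
    using h that by (simp add: lr_hive_def P_def algebra_simps)
  \<comment> \<open>Passing to the row above costs one step in \<open>j\<close>; monotonicity in
    \<open>j\<close> regains it before the next row, so one step suffices at any distance.\<close>
  have Pcol: "P (i + Suc d) (Suc j) \<le> P i j" if "i + Suc d < l" for i d j
    using that
  proof (induction d)
    case 0
    then show ?case using Pstep by simp
  next
    case (Suc d)
    have "P (Suc (i + Suc d)) (Suc j) \<le> P (i + Suc d) j" using Suc.prems by (intro Pstep) simp
    also have "\<dots> \<le> P (i + Suc d) (Suc j)" using Suc.prems by (intro Pmono1) simp
    also have "\<dots> \<le> P i j" using Suc by simp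
    finally show ?case by simp
  qed
  \<comment> \<open>Cell \<open>c\<close> receives the smallest letter whose segment contains it.
    Such a letter exists for \<open>c < \<rho> i\<close>, since
    \<open>P i (Suc i) = \<rho> i\<close>.\<close>
  define t where "t i c = (LEAST j. int c < P i j)" for i c
  define T where "T = restrict (\<lambda>(i, c). t i c) ?D"
  have il: "i < l" if "c < \<rho> i" for i c using l that by (metis leI not_less0)
  have T: "T (i, c) = t i c" if "\<mu> i \<le> c" "c < \<rho> i" for i c
    using that by (simp add: T_def mem_skew_diagram)
  have le_iff: "T (i, c) \<le> j \<longleftrightarrow> int c < P i j" if c: "\<mu> i \<le> c" "c < \<rho> i" for i c j
  proof
    have "int c < P i (Suc i)" using Pfull[of i "Suc i"] il[OF c(2)] c by simp
    then have t: "int c < P i (t i c)" unfolding t_def by (rule LeastI)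
    assume "T (i, c) \<le> j"
    then have "P i (t i c) \<le> P i j" using T[OF c] Pmono[OF il[OF c(2)]] by simp
    then show "int c < P i j" using t by linarith
  next
    assume "int c < P i j"
    then show "T (i, c) \<le> j" unfolding T[OF c] t_def by (rule Least_le)
  qed
  have pos: "1 \<le> T (i, c)" if "\<mu> i \<le> c" "c < \<rho> i" for i c
    using le_iff[OF that, of 0] P0[OF il[OF that(2)]] that by simp
  have eq_iff: "T (i, c) = Suc j \<longleftrightarrow> P i j \<le> int c \<and> int c < P i (Suc j)"
    if "\<mu> i \<le> c" "c < \<rho> i" for i c j
    using le_iff[OF that, of j] le_iff[OF that, of "Suc j"] by linarith
  have N: "int (?N T i (Suc j)) = P i (Suc j) - P i j" if "i < l" for i j
  proof -
    have lo: "int (\<mu> i) \<le> P i j" using P0[OF that] Pmono[OF that, of 0 j] by simp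
    have up: "P i (Suc j) \<le> int (\<rho> i)"
      using Pfull[OF that, of "Suc (i + j)"] Pmono[OF that, of "Suc j" "Suc (i + j)"] by simp
    have m: "P i j \<le> P i (Suc j)" using Pmono1[OF that] .
    \<comment> \<open>The bounds \<open>lo\<close> and \<open>up\<close> keep the segment of letters
      \<open>j + 1\<close> inside the row, and \<open>lo\<close> makes the conversion by
      \<open>nat\<close> exact.\<close>
    have "{c \<in> {\<mu> i..<\<rho> i}. T (i, c) = Suc j} = {nat (P i j)..<nat (P i (Suc j))}"
    proof (intro set_eqI iffI)
      fix c assume "c \<in> {c \<in> {\<mu> i..<\<rho> i}. T (i, c) = Suc j}"
      then show "c \<in> {nat (P i j)..<nat (P i (Suc j))}" using eq_iff[of i c j] by auto
    next
      fix c assume "c \<in> {nat (P i j)..<nat (P i (Suc j))}"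
      then have c: "P i j \<le> int c" "int c < P i (Suc j)" by auto
      then have "\<mu> i \<le> c" "c < \<rho> i" using lo up by linarith+
      then show "c \<in> {c \<in> {\<mu> i..<\<rho> i}. T (i, c) = Suc j}" using eq_iff[of i c j] c by simp
    qed
    then show ?thesis using lo m by (simp add: row_count_def)
  qed
  have h0: "h 0 j = 0" for j using h by (simp add: lr_hive_def)
  have hsum: "h i j = (\<Sum>r<i. P r j)" for i j
    by (induction i) (simp_all add: h0 P_def)
  have Nsum: "int (\<Sum>r<i. ?N T r (Suc j)) = h i (Suc j) - h i j" if "i \<le> l" for i j
    unfolding hsum of_nat_sum using that by (simp add: N sum_subtractf)
  have lat: "(\<Sum>r<Suc i. ?N T r (Suc (Suc j))) \<le> (\<Sum>r<i. ?N T r (Suc j))" if "i < l" for i j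
  proof -
    have "h (Suc i) (Suc (Suc j)) + h i j \<le> h (Suc i) (Suc j) + h i (Suc j)"
      using h that by (simp add: lr_hive_def)
    then have "int (\<Sum>r<Suc i. ?N T r (Suc (Suc j))) \<le> int (\<Sum>r<i. ?N T r (Suc j))"
      using Nsum[of "Suc i" "Suc j"] Nsum[of i j] that by linarith
    then show ?thesis by (simp only: of_nat_le_iff)
  qed
  have "lattice_word (reverse_row_word \<rho> \<mu> T)"
    unfolding lattice_word_iff_row_counts[OF \<rho> l sub]
  proof (intro allI impI ballI)
    fix i b a :: nat
    assume i: "i < l" and b: "b \<in> {\<mu> i..\<rho> i}" and "1 \<le> a"
    then obtain j where j: "a = Suc j" by (cases a) auto
    \<comment> \<open>Counting all of row \<open>i\<close> for the larger letter and none of it for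
      the smaller one only strengthens the inequality, and in that form it is the hive
      inequality.\<close>
    have "card {c \<in> {b..<\<rho> i}. T (i, c) = Suc a} \<le> ?N T i (Suc a)"
      unfolding row_count_def by (rule card_mono) (use b in auto)
    then show "(\<Sum>r<i. ?N T r (Suc a)) + card {c \<in> {b..<\<rho> i}. T (i, c) = Suc a}
       \<le> (\<Sum>r<i. ?N T r a) + card {c \<in> {b..<\<rho> i}. T (i, c) = a}"
      using lat[OF i, of j] unfolding j sum.lessThan_Suc by linarith
  qed
  moreover have "has_content ?D T \<nu>"
    unfolding has_content_def
  proof
    fix j
    have "h l (Suc j) = h l j + int (\<nu> j)" using h by (simp add: lr_hive_def)
    then have "int (\<Sum>r<l. ?N T r (Suc j)) = int (\<nu> j)" using Nsum[of l j] by simp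
    then show "card {c \<in> ?D. T c = Suc j} = \<nu> j"
      unfolding card_skew_entries[OF l] by (simp only: of_nat_eq_iff)
  qed
  moreover have "semistandard ?D T"
    unfolding semistandard_def mem_skew_diagram
  proof (intro conjI allI impI)
    fix i j j' assume a: "\<mu> i \<le> j \<and> j < \<rho> i" "\<mu> i \<le> j' \<and> j' < \<rho> i" "j \<le> j'"
    have "int j' < P i (T (i, j'))" using le_iff[of i j' "T (i, j')"] a by simp
    then have "int j < P i (T (i, j'))" using a by linarith
    then show "T (i, j) \<le> T (i, j')" using le_iff[of i j "T (i, j')"] a by simp
  next
    fix i i' c assume a: "\<mu> i \<le> c \<and> c < \<rho> i" "\<mu> i' \<le> c \<and> c < \<rho> i'" "i < i'"
    obtain j where j: "T (i', c) = Suc j" using pos[of i' c] a by (cases "T (i', c)") auto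
    obtain d where d: "i' = i + Suc d" using a(3) less_imp_Suc_add by fastforce
    have "int c < P i' (Suc j)" using le_iff[of i' c "Suc j"] a j by simp
    also have "\<dots> \<le> P i j" unfolding d using il[of c i'] a d by (intro Pcol) simp
    finally show "T (i, c) < T (i', c)" using le_iff[of i c j] a j by simp
  qed
  moreover have "T \<in> ?D \<rightarrow>\<^sub>E {1..}"
  proof (rule PiE_I)
    fix x assume "x \<in> ?D"
    then show "T x \<in> {1..}" using pos by (cases x) (simp add: mem_skew_diagram)
  next
    fix x assume "x \<notin> ?D"
    then show "T x = undefined" by (simp add: T_def)
  qed
  ultimately show ?thesis unfolding lr_filling_def by blast
qed

text \<open>Only existence is compared, so the two constructions need not be mutually inverse. The
  bound on the entries makes the set of fillings finite, so its cardinality is nonzero as soon as a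
  filling exists.\<close>

lemma lr_coeff_nonzero_iff_hive:
  assumes \<rho>: "is_partition \<rho>" and \<mu>: "is_partition \<mu>" and l: "\<forall>i\<ge>l. \<rho> i = 0"
    and sub: "\<And>i. \<mu> i \<le> \<rho> i"
  shows "lr_coeff \<rho> \<mu> \<nu> \<noteq> 0 \<longleftrightarrow> (\<exists>h. lr_hive l \<rho> \<mu> \<nu> h)"
proof -
  let ?F = "{T. lr_filling \<rho> \<mu> \<nu> T}"
  have coeff: "lr_coeff \<rho> \<mu> \<nu> = card ?F"
    using sub by (simp add: lr_coeff_def lr_filling_def young_subset_iff)
  have "?F \<subseteq> skew_diagram \<rho> \<mu> \<rightarrow>\<^sub>E {..l}"
  proof
    fix T assume "T \<in> ?F"
    then have T: "lr_filling \<rho> \<mu> \<nu> T" by simp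
    then have "\<forall>c \<in> skew_diagram \<rho> \<mu>. T c \<le> l" using lr_filling_imp_hive[OF \<rho> \<mu> l sub] by blast
    then show "T \<in> skew_diagram \<rho> \<mu> \<rightarrow>\<^sub>E {..l}" using T by (auto simp: lr_filling_def PiE_iff)
  qed
  moreover have "finite (skew_diagram \<rho> \<mu>)" using finite_young[OF \<rho>] by (simp add: skew_diagram_def)
  ultimately have "finite ?F" by (meson finite_PiE finite_atMost finite_subset)
  then have "lr_coeff \<rho> \<mu> \<nu> \<noteq> 0 \<longleftrightarrow> (\<exists>T. lr_filling \<rho> \<mu> \<nu> T)"
    unfolding coeff by (simp add: card_eq_0_iff)
  also have "\<dots> \<longleftrightarrow> (\<exists>h. lr_hive l \<rho> \<mu> \<nu> h)"
    using lr_filling_imp_hive[OF \<rho> \<mu> l sub] hive_imp_lr_filling[OF \<rho> \<mu> l sub] by blast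
  finally show ?thesis .
qed

section \<open>Rotation of hives\<close>

text \<open>On the triangle \<open>j \<le> i \<le> l\<close> the map
  \<open>(i, j) \<mapsto> (l - j, i - j)\<close> permutes the corners cyclically, and the rhombus
  families with them. Two sides are traversed backwards, and the term \<open>k * j\<close> turns
  their differences \<open>- \<mu>\<close> and \<open>- \<rho>\<close> into those of the duals;
  subtracting \<open>h l 0\<close> puts 0 at the corner. The \<open>min\<close> continues the array
  constantly beyond the diagonal.\<close>

lemma lr_hive_rotate:
  assumes \<rho>: "antimono \<rho>" "\<And>i. \<rho> i \<le> k" and \<mu>: "antimono \<mu>" "\<And>i. \<mu> i \<le> k"
    and h: "lr_hive l \<rho> \<mu> \<nu> h"
  shows "lr_hive l (dual k l \<mu>) \<nu> (dual k l \<rho>)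
           (\<lambda>i j. h (l - min i j) (i - min i j) + int k * int (min i j) - h l 0)"
    (is "lr_hive l _ \<nu> _ ?g")
proof -
  have h_left: "h i 0 = (\<Sum>r<i. int (\<mu> r))" if "i \<le> l" for i
    using h that by (simp add: lr_hive_def)
  have h_diag: "h i j = (\<Sum>r<i. int (\<rho> r))" if "i \<le> l" "i \<le> j" for i j
    using h that by (simp add: lr_hive_def)
  have h_bottom: "h l (Suc j) = h l j + int (\<nu> j)" for j
    using h by (simp add: lr_hive_def)
  have hA: "h i (Suc j) + h (Suc i) j \<le> h (Suc i) (Suc j) + h i j" if "i < l" for i j
    using h that by (simp add: lr_hive_def)
  have hB: "h (Suc (Suc i)) (Suc j) + h i j \<le> h (Suc i) (Suc j) + h (Suc i) j" if "Suc i < l" for i j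
    using h that by (simp add: lr_hive_def)
  have hC: "h (Suc i) (Suc (Suc j)) + h i j \<le> h (Suc i) (Suc j) + h i (Suc j)" if "i < l" for i j
    using h that by (simp add: lr_hive_def)
  \<comment> \<open>In a filling, the letters 1 of the rows up to \<open>i\<close> lie in different
    columns beyond the first \<open>\<mu> i\<close>, so their number plus \<open>\<mu> i\<close> is
    at most \<open>k\<close>. For the hive, \<open>h (Suc i) 1 - h i 0\<close> weakly decreases with
    \<open>i\<close>, starting from \<open>\<rho> 0\<close>. After the turn this bound is the
    nonnegativity of entry counts next to the diagonal.\<close>
  have first_letter: "h (Suc i) 1 \<le> h i 0 + int k" if "i < l" for i
    using that
  proof (induction i)
    case 0
    then show ?case using h_diag[of 1 1] h_left[of 0] \<rho>(2)[of 0] by simp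
  next
    case (Suc i)
    then show ?case using hB[of i 0] by simp
  qed
  have g_below: "?g i j = h (l - j) (i - j) + int k * int j - h l 0" if "j \<le> i" for i j
    using that by (simp add: min_def)
  have g_above: "?g i j = h (l - i) 0 + int k * int i - h l 0" if "i \<le> j" for i j
    using that by (simp add: min_def)
  have g_diag: "?g i j = (\<Sum>r<i. int (dual k l \<mu> r))" if "i \<le> l" "i \<le> j" for i j
  proof -
    have "h (l - i) 0 + int k * int i - h l 0 = (\<Sum>r<i. int (dual k l \<mu> r))" if "i \<le> l" for i
      using that
    proof (induction i)
      case (Suc i)
      obtain p where p: "l = Suc i + p" using Suc.prems by (metis le_Suc_ex)
      have "h (Suc p) 0 = h p 0 + int (\<mu> p)" using h_left[of p] h_left[of "Suc p"] p by simp
      then show ?case using Suc p \<mu>(2)[of p] by (simp add: dual_def of_nat_diff algebra_simps)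
    qed simp
    then show ?thesis using that g_above by simp
  qed
  show ?thesis unfolding lr_hive_def
  proof (intro conjI allI impI)
    fix i assume "i \<le> l"
    have "h l i = h l 0 + (\<Sum>r<i. int (\<nu> r))" by (induction i) (simp_all add: h_bottom)
    then show "?g i 0 = (\<Sum>r<i. int (\<nu> r))" by simp
  next
    fix i j assume "i \<le> l" "i \<le> j"
    then show "?g i j = (\<Sum>r<i. int (dual k l \<mu> r))" by (rule g_diag)
  next
    fix j
    show "?g l (Suc j) = ?g l j + int (dual k l \<rho> j)"
    proof (cases "j < l")
      case True
      then obtain p where p: "l = Suc j + p" by (metis Suc_leI le_Suc_ex)
      have "h (Suc p) (Suc p) = h p p + int (\<rho> p)"
        using h_diag[of p p] h_diag[of "Suc p" "Suc p"] p by simp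
      then show ?thesis
        using g_below[of "Suc j" l] g_below[of j l] p \<rho>(2)[of p]
        by (simp add: dual_def of_nat_diff algebra_simps)
    next
      case False
      then show ?thesis using g_above[of l j] g_above[of l "Suc j"] by (simp add: dual_def)
    qed
  next
    fix i j assume i: "i < l"
    consider "j < i" | "j = i" | "i < j" by linarith
    then show "?g i (Suc j) + ?g (Suc i) j \<le> ?g (Suc i) (Suc j) + ?g i j"
    proof cases
      case 1
      obtain q where q: "i = Suc j + q" using 1 by (metis Suc_leI le_Suc_ex)
      obtain p where p: "l = Suc j + p" using 1 i by (metis Suc_leI le_Suc_ex less_trans)
      have "h (Suc p) (Suc (Suc q)) + h p q \<le> h (Suc p) (Suc q) + h p (Suc q)" using p by (intro hC) simp
      then show ?thesis
        using g_below[of "Suc j" i] g_below[of j "Suc i"] g_below[of "Suc j" "Suc i"] g_below[of j i] p q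
        by (simp add: algebra_simps)
    next
      case 2
      obtain p where p: "l = Suc i + p" using i by (metis Suc_leI le_Suc_ex)
      have "h (Suc p) 1 \<le> h p 0 + int k" using p by (intro first_letter) simp
      then show ?thesis
        using g_above[of i "Suc i"] g_below[of i "Suc i"] g_above[of "Suc i" "Suc i"] g_above[of i i] p 2
        by (simp add: algebra_simps)
    next
      case 3
      then show ?thesis
        using g_above[of i "Suc j"] g_above[of "Suc i" j] g_above[of "Suc i" "Suc j"] g_above[of i j] by simp
    qed
  next
    fix i j assume i: "Suc i < l"
    show "?g (Suc (Suc i)) (Suc j) + ?g i j \<le> ?g (Suc i) (Suc j) + ?g (Suc i) j"
    proof (cases "j \<le> i")
      case True
      obtain q where q: "i = j + q" using True by (metis le_Suc_ex)
      obtain p where p: "l = Suc j + p" using True i by (metis Suc_leI Suc_lessD le_Suc_ex le_less_trans)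
      have "h p (Suc q) + h (Suc p) q \<le> h (Suc p) (Suc q) + h p q" using p by (intro hA) simp
      then show ?thesis
        using g_below[of "Suc j" "Suc (Suc i)"] g_below[of j i] g_below[of "Suc j" "Suc i"]
          g_below[of j "Suc i"] p q
        by (simp add: algebra_simps Suc_diff_le)
    next
      \<comment> \<open>Here all four values are diagonal sums, and the inequality says that
        \<open>dual k l \<mu>\<close> weakly decreases.\<close>
      case False
      have "\<mu> (l - 1 - i) \<le> \<mu> (l - 1 - Suc i)" by (rule antimonoD[OF \<mu>(1)]) simp
      then have "dual k l \<mu> (Suc i) \<le> dual k l \<mu> i" using i by (simp add: dual_def)
      then show ?thesis
        using g_diag[of "Suc (Suc i)" "Suc j"] g_diag[of i j] g_diag[of "Suc i" "Suc j"]
          g_diag[of "Suc i" j] i False by simp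
    qed
  next
    fix i j assume i: "i < l"
    consider "Suc j \<le> i" | "i \<le> j" by linarith
    then show "?g (Suc i) (Suc (Suc j)) + ?g i j \<le> ?g (Suc i) (Suc j) + ?g i (Suc j)"
    proof cases
      case 1
      obtain q where q: "i = Suc j + q" using 1 by (metis le_Suc_ex)
      obtain p where p: "l = Suc (Suc j) + p" using 1 i by (metis Suc_leI le_Suc_ex le_less_trans)
      have "h (Suc (Suc p)) (Suc q) + h p q \<le> h (Suc p) (Suc q) + h (Suc p) q" using p by (intro hB) simp
      then show ?thesis
        using g_below[of "Suc (Suc j)" "Suc i"] g_below[of j i] g_below[of "Suc j" "Suc i"]
          g_below[of "Suc j" i] p q
        by (simp add: algebra_simps)
    next
      case 2
      then show ?thesis
        using g_above[of "Suc i" "Suc (Suc j)"] g_above[of i j] g_above[of "Suc i" "Suc j"]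
          g_above[of i "Suc j"] by simp
    qed
  qed
qed

section \<open>Three turns of a hive\<close>

lemma dual_dual:
  assumes "\<And>i. \<mu> i \<le> rect k l i"
  shows "dual k l (dual k l \<mu>) = \<mu>"
proof
  fix i
  show "dual k l (dual k l \<mu>) i = \<mu> i" using assms[of i] by (auto simp: dual_def rect_def)
qed

text \<open>One turn gives the forward direction. Three turns restore the data, each partition
  having been dualised twice, so the converse is two further turns.\<close>

lemma lr_hive_dual_iff:
  assumes \<alpha>: "is_partition \<alpha>" "\<And>i. \<alpha> i \<le> rect k l i" and \<mu>: "is_partition \<mu>" "\<And>i. \<mu> i \<le> rect k l i"
    and \<nu>: "is_partition \<nu>" "\<And>i. \<nu> i \<le> rect k l i"
  shows "(\<exists>h. lr_hive l \<alpha> \<mu> \<nu> h) \<longleftrightarrow> (\<exists>h. lr_hive l (dual k l \<mu>) \<nu> (dual k l \<alpha>) h)"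
proof
  have anti: "antimono \<gamma>" "antimono (dual k l \<gamma>)" if "is_partition \<gamma>" "\<And>i. \<gamma> i \<le> rect k l i" for \<gamma>
    using that is_partition_dual[of \<gamma> k l] by (auto simp: is_partition_def young_subset_iff)
  have le: "\<gamma> i \<le> k" if "\<And>i. \<gamma> i \<le> rect k l i" for \<gamma> i
    using that[of i] by (auto simp: rect_def split: if_splits)
  have dle: "dual k l \<gamma> i \<le> k" for \<gamma> i by (simp add: dual_def)
  {
    assume "\<exists>h. lr_hive l \<alpha> \<mu> \<nu> h"
    then show "\<exists>h. lr_hive l (dual k l \<mu>) \<nu> (dual k l \<alpha>) h"
      using lr_hive_rotate anti(1)[OF \<alpha>] anti(1)[OF \<mu>] le[OF \<alpha>(2)] le[OF \<mu>(2)] by blast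
  next
    assume "\<exists>h. lr_hive l (dual k l \<mu>) \<nu> (dual k l \<alpha>) h"
    then have "\<exists>h. lr_hive l (dual k l \<nu>) (dual k l \<alpha>) (dual k l (dual k l \<mu>)) h"
      using lr_hive_rotate anti(2)[OF \<mu>] anti(1)[OF \<nu>] dle le[OF \<nu>(2)] by blast
    then have "\<exists>h. lr_hive l (dual k l (dual k l \<alpha>)) (dual k l (dual k l \<mu>)) (dual k l (dual k l \<nu>)) h"
      using lr_hive_rotate anti(2)[OF \<nu>] anti(2)[OF \<alpha>] dle by blast
    then show "\<exists>h. lr_hive l \<alpha> \<mu> \<nu> h"
      by (simp add: dual_dual \<alpha>(2) \<mu>(2) \<nu>(2))
  }
qed

text \<open>The hive of the filling of \<open>\<rho>/\<mu>\<close> in which every column reads \<open>1, 2, 3, \<dots>\<close>.\<close>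

lemma exists_lr_hive:
  assumes \<rho>: "antimono \<rho>" and \<mu>: "antimono \<mu>" and sub: "\<And>i. \<mu> i \<le> \<rho> i" and l: "\<forall>i\<ge>l. \<rho> i = 0"
  shows "\<exists>\<nu> h. is_partition \<nu> \<and> lr_hive l \<rho> \<mu> \<nu> h"
proof -
  \<comment> \<open>With columns reading \<open>1, 2, 3, ...\<close>, the letter in cell
    \<open>(i, c)\<close> is at most \<open>j\<close> iff the position \<open>j\<close> rows above
    it belongs to \<open>\<mu>\<close> or lies above the first row.\<close>
  define P where "P i j = (if j \<le> i then min (\<rho> i) (\<mu> (i - j)) else \<rho> i)" for i j
  define h where "h i j = (\<Sum>r<i. int (P r j))" for i j
  define \<nu> where "\<nu> j = nat (h l (Suc j) - h l j)" for j
  have \<rho>_step: "\<rho> (Suc i) \<le> \<rho> i" for i by (rule antimonoD[OF \<rho>]) simp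
  have \<mu>_step: "\<mu> (i - j) \<le> \<mu> (i - Suc j)" for i j by (rule antimonoD[OF \<mu>]) simp
  have Pmono: "P i j \<le> P i (Suc j)" for i j
    using \<mu>_step[of i j] by (auto simp: P_def)
  have Pstep: "P (Suc i) (Suc j) \<le> P i j" for i j
    using \<rho>_step[of i] by (auto simp: P_def)
  \<comment> \<open>Every letter \<open>j + 2\<close> lies directly below a letter
    \<open>j + 1\<close>, so row \<open>i + 1\<close> has no more of the former than row
    \<open>i\<close> has of the latter.\<close>
  have Plat: "P (Suc i) (Suc (Suc j)) + P i j \<le> P (Suc i) (Suc j) + P i (Suc j)" for i j
    using \<rho>_step[of i] \<mu>_step[of i j] by (auto simp: P_def min_def)
  have hmono: "h i j \<le> h i (Suc j)" for i j
    unfolding h_def using Pmono by (intro sum_mono) simp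
  have hlat: "h (Suc i) (Suc (Suc j)) + h i j \<le> h (Suc i) (Suc j) + h i (Suc j)" for i j
  proof (induction i)
    case 0
    then show ?case by (simp add: h_def P_def)
  next
    case (Suc i)
    have "int (P (Suc i) (Suc (Suc j))) + int (P i j) \<le> int (P (Suc i) (Suc j)) + int (P i (Suc j))"
      using Plat[of i j] by linarith
    then show ?case using Suc by (simp add: h_def)
  qed
  have \<nu>: "int (\<nu> j) = h l (Suc j) - h l j" for j using hmono[of l j] by (simp add: \<nu>_def)
  have "lr_hive l \<rho> \<mu> \<nu> h" unfolding lr_hive_def
  proof (intro conjI allI impI)
    fix i show "h i 0 = (\<Sum>r<i. int (\<mu> r))" by (simp add: h_def P_def min.absorb2[OF sub])
  next
    fix i j :: nat assume "i \<le> j"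
    then show "h i j = (\<Sum>r<i. int (\<rho> r))" by (simp add: h_def P_def)
  next
    fix j show "h l (Suc j) = h l j + int (\<nu> j)" by (simp add: \<nu>)
  next
    fix i j
    show "h i (Suc j) + h (Suc i) j \<le> h (Suc i) (Suc j) + h i j"
      using Pmono[of i j] by (simp add: h_def)
  next
    fix i j
    show "h (Suc (Suc i)) (Suc j) + h i j \<le> h (Suc i) (Suc j) + h (Suc i) j"
      using Pstep[of i j] by (simp add: h_def)
  next
    fix i j
    show "h (Suc i) (Suc (Suc j)) + h i j \<le> h (Suc i) (Suc j) + h i (Suc j)" by (rule hlat)
  qed
  moreover have "is_partition \<nu>"
  proof -
    have "\<nu> (Suc j) \<le> \<nu> j" for j
    proof -
      \<comment> \<open>Row \<open>l\<close> is empty, so the lattice inequality one row further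
        compares the total numbers of letters \<open>j + 2\<close> and \<open>j + 1\<close>.\<close>
      have "P l i = 0" for i using l by (simp add: P_def)
      then have "h (Suc l) i = h l i" for i by (simp add: h_def)
      then have "int (\<nu> (Suc j)) \<le> int (\<nu> j)" using hlat[of l j] unfolding \<nu> by simp
      then show ?thesis by simp
    qed
    then have "antimono \<nu>" by (simp add: antimono_iff_le_Suc)
    moreover have "{j. \<nu> j \<noteq> 0} \<subseteq> {..<l}"
    proof
      fix j assume "j \<in> {j. \<nu> j \<noteq> 0}"
      moreover have "\<nu> j = 0" if "l \<le> j" using that by (simp add: \<nu>_def h_def P_def)
      ultimately show "j \<in> {..<l}" by (metis lessThan_iff mem_Collect_eq not_le)
    qed
    ultimately show ?thesis by (auto simp: is_partition_def intro: finite_subset)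
  qed
  ultimately show ?thesis by blast
qed

section \<open>Constituents\<close>

text \<open>Strict columns force equal letters into different columns, of which there are only
  \<open>k\<close>.\<close>

lemma content_le_width:
  assumes \<rho>: "\<And>i. \<rho> i \<le> rect k l i" and nz: "lr_coeff \<rho> \<mu> \<nu> \<noteq> 0"
  shows "\<nu> j \<le> k"
proof -
  let ?D = "skew_diagram \<rho> \<mu>"
  have "card {T. lr_filling \<rho> \<mu> \<nu> T} \<noteq> 0"
    using nz by (auto simp: lr_coeff_def lr_filling_def split: if_splits)
  then obtain T where T: "lr_filling \<rho> \<mu> \<nu> T" by (metis card.empty empty_Collect_eq)
  let ?S = "{c \<in> ?D. T c = Suc j}"
  have strict: "T (i, c) < T (i', c)" if "(i, c) \<in> ?D" "(i', c) \<in> ?D" "i < i'" for i i' c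
    using T that unfolding lr_filling_def semistandard_def by blast
  have "inj_on snd ?S"
  proof (rule inj_onI)
    fix x y assume x: "x \<in> ?S" and y: "y \<in> ?S" and "snd x = snd y"
    then obtain i i' c where "x = (i, c)" "y = (i', c)" by (metis prod.collapse)
    then show "x = y" using x y strict[of i c i'] strict[of i' c i] by (cases i i' rule: linorder_cases) auto
  qed
  moreover have "snd ` ?S \<subseteq> {..<k}"
  proof
    fix c assume "c \<in> snd ` ?S"
    then obtain i where "c < \<rho> i" by (auto simp: mem_skew_diagram)
    then show "c \<in> {..<k}" using \<rho>[of i] by (auto simp: rect_def split: if_splits)
  qed
  ultimately have "card ?S \<le> card {..<k}" by (rule card_inj_on_le) simp
  then show ?thesis using T by (simp add: lr_filling_def has_content_def)
qed

text \<open>From second index \<open>l\<close> on the last row of the hive is constant, so no letter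
  above \<open>l\<close> occurs. Containment in the rectangle makes \<open>dual\<close> invertible
  on the constituents of the skew character.\<close>

lemma content_le_rect:
  assumes \<rho>: "is_partition \<rho>" "\<And>i. \<rho> i \<le> rect k l i" and \<mu>: "is_partition \<mu>"
    and nz: "lr_coeff \<rho> \<mu> \<nu> \<noteq> 0"
  shows "\<nu> j \<le> rect k l j"
proof (cases "j < l")
  case True
  then show ?thesis using content_le_width[OF \<rho>(2) nz] by (simp add: rect_def)
next
  case False
  have sub: "\<mu> i \<le> \<rho> i" for i
    using nz by (simp add: lr_coeff_def young_subset_iff split: if_splits)
  have l: "\<forall>i\<ge>l. \<rho> i = 0"
  proof (intro allI impI)
    fix i assume "l \<le> i"
    then show "\<rho> i = 0" using \<rho>(2)[of i] by (simp add: rect_def)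
  qed
  obtain h where h: "lr_hive l \<rho> \<mu> \<nu> h"
    using nz lr_coeff_nonzero_iff_hive[OF \<rho>(1) \<mu> l sub] by blast
  then have "h l m = (\<Sum>r<l. int (\<rho> r))" if "l \<le> m" for m
    using that by (simp add: lr_hive_def)
  from this[of j] this[of "Suc j"] have "h l (Suc j) = h l j" using False by simp
  moreover have "h l (Suc j) = h l j + int (\<nu> j)" using h unfolding lr_hive_def by blast
  ultimately show ?thesis by simp
qed

lemma lookup_frag_sum:
  assumes "finite A"
  shows "Poly_Mapping.lookup (\<Sum>\<alpha>\<in>A. frag_cmul (f \<alpha>) (frag_of \<alpha>)) \<beta> = (if \<beta> \<in> A then f \<beta> else 0)"
  using assms by (simp add: lookup_sum if_distrib sum.delta cong: if_cong)

lemma keys_skew_character: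
  assumes "is_partition \<rho>"
  shows "Poly_Mapping.keys (skew_character \<rho> \<mu>) = {\<alpha>. is_partition \<alpha> \<and> lr_coeff \<rho> \<mu> \<alpha> \<noteq> 0}"
  unfolding skew_character_def using lookup_frag_sum[OF finite_skew_index[OF assms]]
  by (auto simp: in_keys_iff split: if_splits)

lemma keys_schubert_product:
  "Poly_Mapping.keys (schubert_product k l \<mu> \<nu>) =
     {\<alpha>. is_partition \<alpha> \<and> young \<alpha> \<subseteq> young (rect k l) \<and> lr_coeff \<alpha> \<mu> \<nu> \<noteq> 0}"
  unfolding schubert_product_def using lookup_frag_sum[OF finite_schubert_index]
  by (auto simp: in_keys_iff split: if_splits)

lemma lr_coeff_dual_nonzero_iff:
  assumes \<alpha>: "is_partition \<alpha>" "\<And>i. \<alpha> i \<le> rect k l i" and \<mu>: "is_partition \<mu>" "\<And>i. \<mu> i \<le> rect k l i"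
    and \<nu>: "is_partition \<nu>" "\<And>i. \<nu> i \<le> rect k l i" and sub: "\<And>i. \<nu> i \<le> dual k l \<mu> i"
  shows "lr_coeff \<alpha> \<mu> \<nu> \<noteq> 0 \<longleftrightarrow> lr_coeff (dual k l \<mu>) \<nu> (dual k l \<alpha>) \<noteq> 0"
proof -
  have zero: "\<forall>i\<ge>l. \<alpha> i = 0" "\<forall>i\<ge>l. dual k l \<mu> i = 0"
    using \<alpha>(2) by (simp_all add: rect_def dual_def) (metis le_zero_eq not_le)
  have dual: "is_partition (dual k l \<mu>)"
    using \<mu> by (intro is_partition_dual) (auto simp: young_subset_iff)
  \<comment> \<open>\<open>lr_coeff\<close> is 0 by definition unless \<open>\<mu>\<close> is
    contained in \<open>\<alpha>\<close>, so the containment has to come from the hive: the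
    difference of rows \<open>i + 1\<close> and \<open>i\<close> grows from \<open>\<mu> i\<close>
    to \<open>\<alpha> i\<close>.\<close>
  have "\<mu> i \<le> \<alpha> i" if h: "lr_hive l \<alpha> \<mu> \<nu> h" for h i
  proof (cases "i < l")
    case True
    have "h i j + h (Suc i) 0 \<le> h (Suc i) j + h i 0" for j
    proof (induction j)
      case (Suc j)
      have "h i (Suc j) + h (Suc i) j \<le> h (Suc i) (Suc j) + h i j"
        using h True by (simp add: lr_hive_def)
      then show ?case using Suc by simp
    qed simp
    from this[of "Suc i"] show ?thesis using h True by (simp add: lr_hive_def)
  next
    case False
    then show ?thesis using \<mu>(2)[of i] by (simp add: rect_def)
  qed
  then have "lr_coeff \<alpha> \<mu> \<nu> \<noteq> 0 \<longleftrightarrow> (\<exists>h. lr_hive l \<alpha> \<mu> \<nu> h)"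
    using lr_coeff_nonzero_iff_hive[OF \<alpha>(1) \<mu>(1) zero(1)]
    by (metis lr_coeff_def young_subset_iff)
  also have "\<dots> \<longleftrightarrow> (\<exists>h. lr_hive l (dual k l \<mu>) \<nu> (dual k l \<alpha>) h)"
    by (rule lr_hive_dual_iff) (use \<alpha> \<mu> \<nu> in auto)
  also have "\<dots> \<longleftrightarrow> lr_coeff (dual k l \<mu>) \<nu> (dual k l \<alpha>) \<noteq> 0"
    by (rule lr_coeff_nonzero_iff_hive[OF dual \<nu>(1) zero(2) sub, symmetric])
  finally show ?thesis .
qed

section \<open>Exchange of maxima and minima of parts\<close>

lemma Max_diff_eq_diff_Min:
  fixes S :: "nat set"
  assumes "finite S" and "S \<noteq> {}"
  shows "Max ((-) k ` S) = k - Min S"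
proof (rule Max_eqI)
  show "finite ((-) k ` S)" using assms by simp
  show "y \<le> k - Min S" if "y \<in> (-) k ` S" for y
    using that assms by (auto intro!: diff_le_mono2 Min_le)
  show "k - Min S \<in> (-) k ` S" using assms by (intro imageI Min_in)
qed

theorem theorem4p2:
  fixes k l :: nat and \<mu> \<nu> \<beta> :: "nat \<Rightarrow> nat"
  assumes "k > 0" and "l > 0"
    and "is_partition \<mu>" and "is_partition \<nu>"
    and "young \<mu> \<subseteq> young (rect k l)" and "young \<nu> \<subseteq> young (rect k l)"
    and "young \<nu> \<subseteq> young (dual k l \<mu>)"
    and "\<beta> = base_partition (skew_character (dual k l \<mu>) \<nu>)"
  shows "young (cover_partition (schubert_product k l \<mu> \<nu>))
           = rotate180 k l (skew_diagram (rect k l) \<beta>)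
       \<and> cover_partition (schubert_product k l \<mu> \<nu>)
           = (\<lambda>i. if i < l then k - \<beta> (l - 1 - i) else 0)"
proof -
  let ?K = "Poly_Mapping.keys (skew_character (dual k l \<mu>) \<nu>)"
  note \<mu> = assms(3) assms(5)[unfolded young_subset_iff, rule_format]
  note \<nu> = assms(4) assms(6)[unfolded young_subset_iff, rule_format]
  note sub = assms(7)[unfolded young_subset_iff, rule_format]
  have dual\<mu>: "is_partition (dual k l \<mu>)" using assms by (intro is_partition_dual)
  have dual_rect: "dual k l \<gamma> i \<le> rect k l i" for \<gamma> i by (simp add: dual_def rect_def)
  have K: "?K = {\<alpha>. is_partition \<alpha> \<and> lr_coeff (dual k l \<mu>) \<nu> \<alpha> \<noteq> 0}"
    by (rule keys_skew_character[OF dual\<mu>])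
  have K_part: "is_partition \<alpha>" and K_rect: "\<alpha> i \<le> rect k l i" if "\<alpha> \<in> ?K" for \<alpha> i
    using that content_le_rect[OF dual\<mu> dual_rect \<nu>(1)] by (auto simp: K)
  have schubert: "Poly_Mapping.keys (schubert_product k l \<mu> \<nu>) = dual k l ` ?K"
  proof (intro set_eqI iffI)
    fix \<alpha> assume "\<alpha> \<in> Poly_Mapping.keys (schubert_product k l \<mu> \<nu>)"
    then have \<alpha>: "is_partition \<alpha>" "\<And>i. \<alpha> i \<le> rect k l i" and nz: "lr_coeff \<alpha> \<mu> \<nu> \<noteq> 0"
      by (auto simp: keys_schubert_product young_subset_iff)
    have "is_partition (dual k l \<alpha>)" using \<alpha> by (intro is_partition_dual) (auto simp: young_subset_iff)
    then have "dual k l \<alpha> \<in> ?K"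
      using nz lr_coeff_dual_nonzero_iff[OF \<alpha> \<mu> \<nu> sub] by (simp add: K)
    moreover have "\<alpha> = dual k l (dual k l \<alpha>)" using dual_dual \<alpha>(2) by metis
    ultimately show "\<alpha> \<in> dual k l ` ?K" by blast
  next
    fix \<alpha> assume "\<alpha> \<in> dual k l ` ?K"
    then obtain \<gamma> where \<gamma>: "\<gamma> \<in> ?K" and \<alpha>: "\<alpha> = dual k l \<gamma>" by blast
    have part: "is_partition \<alpha>"
      unfolding \<alpha> using K_part[OF \<gamma>] K_rect[OF \<gamma>] by (intro is_partition_dual) (auto simp: young_subset_iff)
    have rect: "\<alpha> i \<le> rect k l i" for i unfolding \<alpha> by (rule dual_rect)
    have "dual k l \<alpha> = \<gamma>" unfolding \<alpha> by (rule dual_dual[OF K_rect[OF \<gamma>]])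
    then have "lr_coeff \<alpha> \<mu> \<nu> \<noteq> 0"
      using \<gamma> lr_coeff_dual_nonzero_iff[OF part rect \<mu> \<nu> sub] by (simp add: K)
    then show "\<alpha> \<in> Poly_Mapping.keys (schubert_product k l \<mu> \<nu>)"
      using part rect by (simp add: keys_schubert_product young_subset_iff)
  qed
  \<comment> \<open>Without a constituent the \<open>Min\<close> and \<open>Max\<close> below would
    be unspecified.\<close>
  have "?K \<noteq> {}"
  proof -
    have zero: "\<forall>i\<ge>l. dual k l \<mu> i = 0" by (simp add: dual_def)
    have "antimono (dual k l \<mu>)" "antimono \<nu>" using dual\<mu> \<nu> by (auto simp: is_partition_def)
    then obtain \<alpha> h where "is_partition \<alpha>" "lr_hive l (dual k l \<mu>) \<nu> \<alpha> h"
      using exists_lr_hive[OF _ _ sub zero] by blast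
    then have "\<alpha> \<in> ?K" using lr_coeff_nonzero_iff_hive[OF dual\<mu> \<nu>(1) zero sub] by (auto simp: K)
    then show ?thesis by blast
  qed
  have base: "\<beta> i = Min ((\<lambda>\<alpha>. \<alpha> i) ` ?K)" for i
    unfolding assms(8) base_partition_def by (simp add: Setcompr_eq_image)
  have cover: "cover_partition (schubert_product k l \<mu> \<nu>) = dual k l \<beta>"
  proof
    fix i
    have eq: "cover_partition (schubert_product k l \<mu> \<nu>) i = Max ((\<lambda>\<alpha>. dual k l \<alpha> i) ` ?K)"
      unfolding cover_partition_def schubert by (simp add: Setcompr_eq_image image_image)
    show "cover_partition (schubert_product k l \<mu> \<nu>) i = dual k l \<beta> i"
    proof (cases "i < l")
      case True
      then have "(\<lambda>\<alpha>. dual k l \<alpha> i) ` ?K = (-) k ` (\<lambda>\<alpha>. \<alpha> (l - 1 - i)) ` ?K"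
        by (simp add: dual_def image_image)
      then have "Max ((\<lambda>\<alpha>. dual k l \<alpha> i) ` ?K) = k - Min ((\<lambda>\<alpha>. \<alpha> (l - 1 - i)) ` ?K)"
        using Max_diff_eq_diff_Min[of "(\<lambda>\<alpha>. \<alpha> (l - 1 - i)) ` ?K" k] \<open>?K \<noteq> {}\<close> by simp
      then show ?thesis using True by (simp add: eq base dual_def)
    next
      case False
      then have "dual k l \<alpha> i = 0" for \<alpha> by (simp add: dual_def)
      \<comment> \<open>From index \<open>l\<close> on all parts are 0, and the maximum is taken
        over \<open>{0}\<close> rather than over the empty set.\<close>
      then have "(\<lambda>\<alpha>. dual k l \<alpha> i) ` ?K = {0}" using \<open>?K \<noteq> {}\<close> by (simp add: image_constant_conv)
      then show ?thesis using False by (simp add: eq dual_def)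
    qed
  qed
  \<comment> \<open>The description of the dual as a rotated complement is available for
    \<open>\<beta>\<close> inside the rectangle; any single constituent bounds
    \<open>\<beta>\<close>.\<close>
  have "\<beta> i \<le> rect k l i" for i
  proof -
    obtain \<alpha> where \<alpha>: "\<alpha> \<in> ?K" using \<open>?K \<noteq> {}\<close> by blast
    then have "\<beta> i \<le> \<alpha> i" unfolding base by (intro Min_le) auto
    also have "\<dots> \<le> rect k l i" by (rule K_rect[OF \<alpha>])
    finally show ?thesis .
  qed
  then have "young (dual k l \<beta>) = rotate180 k l (skew_diagram (rect k l) \<beta>)"
    by (intro young_dual) (simp add: young_subset_iff)
  then show ?thesis unfolding cover by (simp add: dual_def)
qed

end
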